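(* Let $n\ge 1$. The function $\tilde d:\tilde{\mathcal B}_n\times\tilde{\mathcal B}_n\to\mathbb R$ defined by $$\tilde d(\alpha,\beta):=\inf\{d(P_1,P_2)\mid P_1,P_2\in\mathcal B_n,\ [P_1]=\alpha,\ [P_2]=\beta\}$$ is a metric on $\tilde{\mathcal B}_n$.
   Context: A body in $\mathbb R^n$ is a compact subset of $\mathbb R^n$ that is the closure of an open subset of $\mathbb R^n$; $\mathcal B_n$ denotes the set of all bodies in $\mathbb R^n$. The integral affine transformation group $G_n=\mathrm{AGL}(n,\mathbb Z)$ is the set $\mathrm{GL}(n,\mathbb Z)\times\mathbb R^n$ with multiplication $(A_1,t_1)\cdot(A_2,t_2)=(A_1A_2,\,A_1t_2+t_1)$; it acts on $\mathbb R^n$ by $(A,t)x=Ax+t$ and hence on $\mathcal B_n$ by taking images. The moduli space of bodies is the orbit set $\tilde{\mathcal B}_n:=\mathcal B_n/G_n$, and $[P]\in\tilde{\mathcal B}_n$ denotes the orbit of $P\in\mathcal B_n$. The function $d:\mathcal B_n\times\mathcal B_n\to\mathbb R$ is $d(A,B):=\mathrm{vol}_n(A\bigtriangleup B)$, where $A\bigtriangleup B=(A\setminus B)\cup(B\setminus A)$ and $\mathrm{vol}_n$ is $n$-dimensional Lebesgue measure; $d$ is a metric on $\mathcal B_n$. *)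

theory Defs
  imports "HOL-Analysis.Analysis" "HOL-Algebra.Group_Action"
begin

text \<open>
  The space \<open>\<real>\<^sup>n\<close> is \<^typ>\<open>real^'n\<close> with \<open>n = CARD('n)\<close>; index types are finite and nonempty,
  so \<open>n \<ge> 1\<close> is automatic.
\<close>

text \<open>The empty set is a body, being the closure of the open set \<open>{}\<close>.\<close>
definition bodies :: "(real^'n) set set" where
  "bodies = {P. compact P \<and> (\<exists>U. open U \<and> P = closure U)}"

text \<open>
  \<open>GL(n,\<int>)\<close> consists of the integer matrices that are invertible over the integers.
  The translation parts are arbitrary real vectors.
\<close>
definition GL_int :: "(int^'n^'n) set" where
  "GL_int = {A. invertible A}"

definition agl_apply :: "(int^'n^'n) \<times> (real^'n) \<Rightarrow> real^'n \<Rightarrow> real^'n" where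
  "agl_apply g x = map_matrix real_of_int (fst g) *v x + snd g"

definition AGL_int :: "((int^'n^'n) \<times> (real^'n)) monoid" where
  "AGL_int = \<lparr>carrier = GL_int \<times> UNIV,
     monoid.mult = (\<lambda>(A1, t1) (A2, t2). (A1 ** A2, map_matrix real_of_int A1 *v t2 + t1)),
     one = (mat 1, 0)\<rparr>"

text \<open>The restriction to bodies is what \<^locale>\<open>group_action\<close> requires of an action.\<close>
definition body_action :: "(int^'n^'n) \<times> (real^'n) \<Rightarrow> (real^'n) set \<Rightarrow> (real^'n) set" where
  "body_action g = (\<lambda>P\<in>bodies. agl_apply g ` P)"

abbreviation body_class :: "(real^'n) set \<Rightarrow> (real^'n) set set" where
  "body_class P \<equiv> orbit AGL_int body_action P"

definition body_moduli :: "(real^'n) set set set" where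
  "body_moduli = orbits AGL_int bodies body_action"

definition body_dist :: "(real^'n) set \<Rightarrow> (real^'n) set \<Rightarrow> real" where
  "body_dist A B = measure lebesgue (sym_diff A B)"

text \<open>
  The locale \<^locale>\<open>Metric_space\<close> asks for nonnegativity and symmetry on the whole type, whereas
  the infimum is only meaningful on \<^const>\<open>body_moduli\<close>; off it the function is set to \<open>0\<close>.
\<close>
definition moduli_dist :: "(real^'n) set set \<Rightarrow> (real^'n) set set \<Rightarrow> real" where
  "moduli_dist \<alpha> \<beta> =
     (if \<alpha> \<in> body_moduli \<and> \<beta> \<in> body_moduli
      then Inf {body_dist P1 P2 | P1 P2.
             P1 \<in> bodies \<and> P2 \<in> bodies \<and> body_class P1 = \<alpha> \<and> body_class P2 = \<beta>}
      else 0)"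

lemma map_matrix_of_int_mult:
  "map_matrix real_of_int (A ** B) = map_matrix real_of_int A ** map_matrix real_of_int B"
  by (simp add: vec_eq_iff matrix_matrix_mult_def)

lemma map_matrix_of_int_one: "map_matrix real_of_int (mat 1) = mat 1"
  by (simp add: vec_eq_iff mat_def)

lemma agl_apply_mult:
  "agl_apply (g \<otimes>\<^bsub>AGL_int\<^esub> h) x = agl_apply g (agl_apply h x)"
  by (cases g; cases h)
     (simp add: AGL_int_def agl_apply_def map_matrix_of_int_mult matrix_vector_mul_assoc
        matrix_vector_right_distrib)

lemma agl_apply_one: "agl_apply \<one>\<^bsub>AGL_int\<^esub> x = x"
  by (simp add: AGL_int_def agl_apply_def map_matrix_of_int_one)

lemma group_AGL_int: "group (AGL_int :: ((int^'n^'n) \<times> (real^'n)) monoid)"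
proof (rule groupI)
  fix g :: "(int^'n^'n) \<times> (real^'n)"
  assume "g \<in> carrier AGL_int"
  then obtain A t where g: "g = (A, t)" and A: "invertible A"
    by (auto simp: AGL_int_def GL_int_def)
  then obtain B where B: "A ** B = mat 1" "B ** A = mat 1"
    by (auto simp: invertible_def)
  then have "invertible B"
    by (auto simp: invertible_def)
  with B g show "\<exists>h\<in>carrier AGL_int. h \<otimes>\<^bsub>AGL_int\<^esub> g = \<one>\<^bsub>AGL_int\<^esub>"
    by (intro bexI[of _ "(B, - (map_matrix real_of_int B *v t))"])
       (auto simp: AGL_int_def GL_int_def)
next
  show "\<one>\<^bsub>AGL_int\<^esub> \<in> carrier (AGL_int :: ((int^'n^'n) \<times> (real^'n)) monoid)"
    by (auto simp: AGL_int_def GL_int_def invertible_def intro!: exI[of _ "mat 1"])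
qed (auto simp: AGL_int_def GL_int_def invertible_mult matrix_mul_assoc map_matrix_of_int_mult
      map_matrix_of_int_one matrix_vector_mul_assoc matrix_vector_right_distrib)

lemma agl_apply_bodies:
  assumes g: "g \<in> carrier AGL_int" and P: "P \<in> bodies"
  shows "agl_apply g ` P \<in> bodies"
proof -
  let ?L = "(*v) (map_matrix real_of_int (fst g))"
  from P obtain U where "compact P" and U: "open U" "P = closure U"
    by (auto simp: bodies_def)
  obtain B where "fst g ** B = mat 1" "B ** fst g = mat 1"
    using g by (auto simp: AGL_int_def GL_int_def invertible_def)
  then have "map_matrix real_of_int (fst g) ** map_matrix real_of_int B = mat 1"
      "map_matrix real_of_int B ** map_matrix real_of_int (fst g) = mat 1"
    by (simp_all add: map_matrix_of_int_one flip: map_matrix_of_int_mult)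
  then have inv: "invertible (map_matrix real_of_int (fst g))"
    unfolding invertible_def by blast
  then have inj: "inj ?L"
    by (rule inj_matrix_vector_mult)
  have lin: "linear ?L" by simp
  have img: "agl_apply g ` S = (+) (snd g) ` ?L ` S" for S
    by (auto simp: agl_apply_def image_image add.commute)
  have "compact (agl_apply g ` P)"
    unfolding img
    by (intro compact_translation compact_continuous_image \<open>compact P\<close> linear_continuous_on)
       (simp add: linear_conv_bounded_linear[symmetric])
  moreover have "open (agl_apply g ` U)"
    unfolding img
    by (intro open_translation open_surjective_linear_image U lin
          linear_injective_imp_surjective[OF lin inj refl])
  moreover have "agl_apply g ` P = closure (agl_apply g ` U)"
    unfolding img U(2) closure_translation closure_injective_linear_image[OF lin inj] ..
  ultimately show ?thesis
    by (auto simp: bodies_def)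
qed

lemma group_action_bodies:
  "group_action (AGL_int :: ((int^'n^'n) \<times> (real^'n)) monoid) bodies body_action"
proof -
  let ?G = "AGL_int :: ((int^'n^'n) \<times> (real^'n)) monoid"
  interpret G: group ?G by (rule group_AGL_int)
  have act_mult: "agl_apply (g \<otimes>\<^bsub>?G\<^esub> h) ` P = agl_apply g ` agl_apply h ` P" for g h P
    by (simp add: image_image agl_apply_mult)
  have act_one: "agl_apply \<one>\<^bsub>?G\<^esub> ` P = P" for P
    by (simp add: agl_apply_one)
  have bij: "body_action g \<in> Bij bodies" if g: "g \<in> carrier ?G" for g
  proof -
    have "bij_betw (body_action g) bodies bodies"
      using g
      by (intro bij_betw_byWitness[where f' = "body_action (inv\<^bsub>?G\<^esub> g)"])
         (auto simp: body_action_def agl_apply_bodies act_one simp flip: act_mult)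
    then show ?thesis
      by (simp add: Bij_def body_action_def)
  qed
  have "body_action \<in> hom ?G (BijGroup bodies)"
  proof (rule homI)
    fix g h assume gh: "g \<in> carrier ?G" "h \<in> carrier ?G"
    have "body_action (g \<otimes>\<^bsub>?G\<^esub> h) P = compose bodies (body_action g) (body_action h) P" for P
      using gh by (simp add: body_action_def compose_def agl_apply_bodies act_mult)
    then show "body_action (g \<otimes>\<^bsub>?G\<^esub> h) = body_action g \<otimes>\<^bsub>BijGroup bodies\<^esub> body_action h"
      using gh by (simp add: BijGroup_def bij fun_eq_iff)
  qed (simp add: BijGroup_def bij)
  then show ?thesis
    by (simp add: group_action_def group_hom_def group_hom_axioms_def G.is_group group_BijGroup)
qed

end

theory Submission
  imports Defs
begin

text \<open>
  The group acts by isometries of the volume distance, because integer matrices in \<open>GL(n,\<int>)\<close> have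
  determinant \<open>\<plusminus>1\<close>; so the infimum over orbits is a pseudometric, and it is definite once orbits are
  closed. Let \<open>g\<^sub>k Q\<close> converge to \<open>P \<noteq> {}\<close>. Eventually \<open>g\<^sub>k Q\<close> meets \<open>P\<close> in more than half the volume
  of \<open>P\<close>. As \<open>P\<close> is bounded, a long row of the matrix of \<open>g\<^sub>k\<close> would confine \<open>Q \<inter> g\<^sub>k\<^sup>-\<^sup>1 P\<close> to a thin slab of
  small volume, so these matrices are bounded. Being integral they are constant along a
  subsequence, the translation parts converge along a further one, and the limit transformation
  maps \<open>Q\<close> to \<open>P\<close>.
\<close>

section \<open>Lebesgue measure of linear images in \<open>real^'n\<close>\<close>

text \<open>
  The library's \<open>measure_linear_image\<close> needs a well-ordered index type, since it computes the
  determinant of a shear as that of a triangular matrix.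
\<close>
lemma
  fixes f :: "real^'n \<Rightarrow> real^'n"
  assumes "linear f" "S \<in> lmeasurable"
  shows measurable_linear_image_cart: "f ` S \<in> lmeasurable"
    and measure_linear_image_cart:
      "measure lebesgue (f ` S) = \<bar>det (matrix f)\<bar> * measure lebesgue S"
proof -
  let ?P = "\<lambda>f::real^'n \<Rightarrow> real^'n. \<forall>S\<in>lmeasurable. f ` S \<in> lmeasurable \<and>
      measure lebesgue (f ` S) = \<bar>det (matrix f)\<bar> * measure lebesgue S"
  have "?P f"
  proof (rule induct_linear_elementary[OF \<open>linear f\<close>])
    fix f g :: "real^'n \<Rightarrow> real^'n"
    assume "linear f" "linear g" "?P f" "?P g"
    then show "?P (f \<circ> g)"
      by (simp add: matrix_compose det_mul abs_mult image_comp[symmetric] del: o_apply)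
  next
    fix f :: "real^'n \<Rightarrow> real^'n" and i
    assume "linear f" and 0: "\<And>x. f x $ i = 0"
    \<comment> \<open>Both sides vanish: the image lies in the hyperplane where coordinate
      \<open>i\<close> is 0, and row \<open>i\<close> of the matrix is 0.\<close>
    have "negligible (f ` S)" for S
      by (rule negligible_subset[OF negligible_standard_hyperplane_cart[of i]]) (auto simp: 0)
    moreover have "row i (matrix f) = 0"
      by (simp add: row_def matrix_def 0 vec_eq_iff)
    ultimately show "?P f"
      by (simp add: negligible_iff_measure det_zero_row(2))
  next
    fix c :: "'n \<Rightarrow> real"
    have "det (matrix (\<lambda>x. \<chi> i. c i * x $ i)) = prod c UNIV"
      by (subst det_diagonal) (auto simp: matrix_def axis_def)
    then show "?P (\<lambda>x. \<chi> i. c i * x $ i)"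
      by (simp add: measurable_stretch measure_stretch)
  next
    fix m n :: 'n
    assume "m \<noteq> n"
    let ?\<tau> = "Transposition.transpose m n"
    let ?h = "\<lambda>x::real^'n. \<chi> i. x $ ?\<tau> i"
    have lin: "linear ?h"
      by (rule linearI) (auto simp: vec_eq_iff)
    have "?h ` cbox a b = cbox (?h a) (?h b)" for a b
    proof
      show "?h ` cbox a b \<subseteq> cbox (?h a) (?h b)"
        by (auto simp: mem_box_cart)
      show "cbox (?h a) (?h b) \<subseteq> ?h ` cbox a b"
      proof
        fix x assume "x \<in> cbox (?h a) (?h b)"
        then have "a $ i \<le> x $ ?\<tau> i \<and> x $ ?\<tau> i \<le> b $ i" for i
          by (auto simp: mem_box_cart dest: spec[of _ "?\<tau> i"])
        then have "?h x \<in> cbox a b"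
          by (simp add: mem_box_cart)
        \<comment> \<open>\<open>?h\<close> is an involution, so the preimage of \<open>x\<close> is
          \<open>?h x\<close> itself.\<close>
        moreover have "x = ?h (?h x)"
          by (simp add: vec_eq_iff)
        ultimately show "x \<in> ?h ` cbox a b"
          by blast
      qed
    qed
    moreover have "measure lebesgue (cbox (?h a) (?h b)) = measure lebesgue (cbox a b)" for a b
    proof -
      have "(\<Prod>i\<in>UNIV. b $ ?\<tau> i - a $ ?\<tau> i) = (\<Prod>i\<in>UNIV. b $ i - a $ i)"
        by (intro prod.reindex_bij_betw[where g = "\<lambda>i. b $ i - a $ i"]) simp
      moreover have "(\<exists>i. b $ ?\<tau> i < a $ ?\<tau> i) \<longleftrightarrow> (\<exists>i. b $ i < a $ i)"
        by (metis transpose_involutory)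
      ultimately show ?thesis
        by (simp add: content_cbox_if_cart interval_eq_empty_cart)
    qed
    ultimately have cbox_eq:
      "measure lebesgue (?h ` cbox a b) = 1 * measure lebesgue (cbox a b)" for a b
      by simp
    have *: "?h ` S \<in> lmeasurable \<and> measure lebesgue (?h ` S) = measure lebesgue S"
      if "S \<in> lmeasurable" for S
      using measure_linear_sufficient[OF lin that cbox_eq] by simp
    have "matrix ?h = (\<chi> i. mat 1 $ ?\<tau> i)"
      by (auto simp: matrix_def mat_def axis_def vec_eq_iff)
    then have "\<bar>det (matrix ?h)\<bar> = 1"
      by (simp add: det_permute_rows permutes_swap_id sign_def)
    with * show "?P ?h" by simp
  next
    fix m n :: 'n
    assume "m \<noteq> n"
    let ?h = "\<lambda>x::real^'n. \<chi> i. if i = m then x $ m + x $ n else x $ i"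
    have lin: "linear ?h"
      by (rule linearI) (auto simp: vec_eq_iff algebra_simps)
    have cbox_eq: "measure lebesgue (?h ` cbox a b) = 1 * measure lebesgue (cbox a b)" for a b
    proof (cases "cbox a b = {}")
      case False
      \<comment> \<open>\<open>measure_shear_interval\<close> requires a nonnegative
        \<open>n\<close>-th coordinate in the lower corner of the box. Translating that corner to 0
        secures this, and translations do not change measure.\<close>
      have cb: "cbox a b = (+) a ` cbox 0 (b - a)"
        by (simp flip: cbox_translation)
      with False have ne: "cbox 0 (b - a) \<noteq> {}" by auto
      have "?h ` cbox a b = (+) (?h a) ` ?h ` cbox 0 (b - a)"
        unfolding cb image_image by (intro image_cong refl) (auto simp: vec_eq_iff)
      then have "measure lebesgue (?h ` cbox a b) = measure lebesgue (?h ` cbox 0 (b - a))"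
        by (simp only: measure_translation)
      also have "\<dots> = measure lebesgue (cbox 0 (b - a))"
        using measure_shear_interval[OF \<open>m \<noteq> n\<close> ne] by simp
      also have "\<dots> = measure lebesgue (cbox a b)"
        unfolding cb by (simp only: measure_translation)
      finally show ?thesis by simp
    qed simp
    have *: "?h ` S \<in> lmeasurable \<and> measure lebesgue (?h ` S) = measure lebesgue S"
      if "S \<in> lmeasurable" for S
      using measure_linear_sufficient[OF lin that cbox_eq] by simp
    \<comment> \<open>The shear matrix arises from the identity by adding row \<open>n\<close> to
      row \<open>m\<close>, which leaves the determinant unchanged.\<close>
    have "matrix ?h = (\<chi> k. if k = m then row m (mat 1) + 1 *s row n (mat 1) else row k (mat 1))"
      by (simp add: matrix_def mat_def axis_def row_def vec_eq_iff)
    then have "det (matrix ?h) = 1"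
      by (simp only: det_row_operation[OF \<open>m \<noteq> n\<close>] det_I)
    with * show "?P ?h" by simp
  qed
  with \<open>S \<in> lmeasurable\<close> show "f ` S \<in> lmeasurable"
      "measure lebesgue (f ` S) = \<bar>det (matrix f)\<bar> * measure lebesgue S"
    by auto
qed

section \<open>Volume preservation by integral affine transformations\<close>

lemma det_map_matrix_of_int: "det (map_matrix real_of_int A) = real_of_int (det A)"
  by (simp add: det_def)

text \<open>The inverse is integral as well, so \<open>det A\<close> is a unit of the
  integers.\<close>

lemma abs_det_GL_int:
  assumes "A \<in> GL_int"
  shows "\<bar>det (map_matrix real_of_int A)\<bar> = 1"
proof -
  obtain B where "A ** B = mat 1"
    using assms by (auto simp: GL_int_def invertible_def)
  then have "det A * det B = 1"
    by (metis det_mul det_I)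
  then have "\<bar>det A\<bar> = 1"
    by (auto simp: zmult_eq_1_iff)
  then show ?thesis
    by (simp add: det_map_matrix_of_int flip: of_int_abs)
qed

lemma agl_apply_image:
  "agl_apply g ` S = (+) (snd g) ` (*v) (map_matrix real_of_int (fst g)) ` S"
  by (auto simp: agl_apply_def image_image add.commute)

lemma
  assumes "g \<in> carrier AGL_int" "S \<in> lmeasurable"
  shows measurable_agl_image: "agl_apply g ` S \<in> lmeasurable"
    and measure_agl_image: "measure lebesgue (agl_apply g ` S) = measure lebesgue S"
proof -
  have "fst g \<in> GL_int"
    using assms(1) by (auto simp: AGL_int_def)
  then show "agl_apply g ` S \<in> lmeasurable"
      "measure lebesgue (agl_apply g ` S) = measure lebesgue S"
    using assms(2)
    by (auto simp: agl_apply_image measure_translation measurable_translation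
        measurable_linear_image_cart measure_linear_image_cart abs_det_GL_int)
qed

lemma agl_apply_inv:
  assumes "g \<in> carrier AGL_int"
  shows "agl_apply (inv\<^bsub>AGL_int\<^esub> g) (agl_apply g x) = x"
  by (metis agl_apply_mult agl_apply_one assms group.l_inv group_AGL_int)

lemma inj_agl_apply: "g \<in> carrier AGL_int \<Longrightarrow> inj (agl_apply g)"
  by (metis agl_apply_inv injI)

lemma body_dist_agl_image:
  assumes "g \<in> carrier AGL_int" "compact P" "compact Q"
  shows "body_dist (agl_apply g ` P) (agl_apply g ` Q) = body_dist P Q"
proof -
  have "sym_diff (agl_apply g ` P) (agl_apply g ` Q) = agl_apply g ` sym_diff P Q"
    by (simp add: image_Un image_set_diff[OF inj_agl_apply[OF assms(1)]])
  moreover have "sym_diff P Q \<in> lmeasurable"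
    by (intro fmeasurable.Un fmeasurable.Diff lmeasurable_compact assms)
  ultimately show ?thesis
    by (simp add: body_dist_def measure_agl_image[OF assms(1)])
qed

section \<open>Volume distance between bodies\<close>

lemma body_dist_nonneg: "0 \<le> body_dist P Q"
  by (simp add: body_dist_def)

lemma body_dist_commute: "body_dist P Q = body_dist Q P"
  by (simp add: body_dist_def Un_commute)

lemma body_dist_triangle:
  assumes "compact P" "compact Q" "compact R"
  shows "body_dist P R \<le> body_dist P Q + body_dist Q R"
proof -
  have m: "sym_diff A B \<in> lmeasurable" if "compact A" "compact B" for A B :: "(real^'n) set"
    by (intro fmeasurable.Un fmeasurable.Diff lmeasurable_compact that)
  have "body_dist P R \<le> measure lebesgue (sym_diff P Q \<union> sym_diff Q R)"
    unfolding body_dist_def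
    by (rule measure_mono_fmeasurable) (use assms m in \<open>auto simp: fmeasurableD\<close>)
  also have "\<dots> \<le> body_dist P Q + body_dist Q R"
    unfolding body_dist_def by (intro measure_Un_le fmeasurableD m assms)
  finally show ?thesis .
qed

lemma measure_le_body_dist:
  assumes "compact P" "compact Q" "S \<in> sets lebesgue" "S \<subseteq> P - Q"
  shows "measure lebesgue S \<le> body_dist P Q"
proof -
  have "sym_diff P Q \<in> lmeasurable"
    by (intro fmeasurable.Un fmeasurable.Diff lmeasurable_compact assms)
  then show ?thesis
    unfolding body_dist_def using assms by (intro measure_mono_fmeasurable) auto
qed

text \<open>If the open set \<open>U\<close> with closure \<open>P\<close> lay inside the closed set
  \<open>Q\<close>, so would \<open>P\<close>. Hence \<open>U - Q\<close> is open and nonempty. This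
  turns a set-theoretic difference between bodies into a difference of positive volume.\<close>

lemma body_ball_in_diff:
  assumes "P \<in> bodies" "closed Q" "\<not> P \<subseteq> Q"
  obtains x e where "0 < e" "ball x e \<subseteq> P - Q"
proof -
  obtain U where U: "open U" "P = closure U"
    using assms by (auto simp: bodies_def)
  with assms have "\<not> U \<subseteq> Q"
    using closure_minimal by blast
  then obtain x where "x \<in> U - Q" by blast
  moreover have "open (U - Q)"
    using U assms by blast
  ultimately obtain e where "0 < e" "ball x e \<subseteq> U - Q"
    by (meson open_contains_ball)
  with U show ?thesis
    using closure_subset by (intro that[of e x]) auto
qed

lemma body_measure_pos:
  assumes "P \<in> bodies" "P \<noteq> {}"
  shows "0 < measure lebesgue P"
proof -
  \<comment> \<open>Taking the empty set for \<open>Q\<close> yields a ball inside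
    \<open>P\<close>.\<close>
  obtain x e where "0 < e" "ball x e \<subseteq> P"
    using body_ball_in_diff[OF assms(1), of "{}"] assms(2)
    by (metis Diff_empty closed_empty subset_empty)
  moreover have "P \<in> lmeasurable"
    using assms by (auto simp: bodies_def lmeasurable_compact)
  ultimately have "measure lebesgue (ball x e) \<le> measure lebesgue P"
    by (intro measure_mono_fmeasurable) auto
  moreover have "0 < measure lebesgue (ball x e)"
    using content_ball_pos[OF \<open>0 < e\<close>, of x] by simp
  ultimately show ?thesis
    by linarith
qed

section \<open>Boundedness of transformations with large overlap\<close>

text \<open>Sliding the slab along its normal \<open>a\<close> gives \<open>N + 1\<close> disjoint copies, all inside the larger ball.\<close>
lemma measure_slab_bound:
  fixes a :: "'a::euclidean_space"
  assumes S: "S \<in> lmeasurable" "S \<subseteq> cball 0 r"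
    and slab: "\<And>x. x \<in> S \<Longrightarrow> \<bar>a \<bullet> x + c\<bar> \<le> R"
    and "0 \<le> R" "0 < N" and N: "real N * (2 * R + 1) \<le> norm a"
  shows "(real N + 1) * measure lebesgue S \<le> measure lebesgue (cball (0::'a) (r + 1))"
proof -
  \<comment> \<open>The length of \<open>w\<close> is chosen so that a shift by \<open>w\<close>
    raises the inner product with \<open>a\<close> by \<open>2 * R + 1\<close>, more than the width
    \<open>2 * R\<close> of the range allowed on \<open>S\<close>; distinct multiples therefore give
    disjoint copies. The bound on \<open>norm a\<close> gives
    \<open>real N * norm w \<le> 1\<close>, which is why radius \<open>r + 1\<close>
    suffices.\<close>
  define w where "w = ((2 * R + 1) / (norm a)\<^sup>2) *\<^sub>R a"
  have "0 < real N * (2 * R + 1)"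
    using \<open>0 \<le> R\<close> \<open>0 < N\<close> by simp
  with N have a: "0 < norm a" by linarith
  have aw: "a \<bullet> w = 2 * R + 1"
    using a by (simp add: w_def power2_norm_eq_inner)
  have nw: "norm w = (2 * R + 1) / norm a"
    using a \<open>0 \<le> R\<close> by (simp add: w_def power2_eq_square)
  let ?F = "\<lambda>j::nat. (+) (real j *\<^sub>R w) ` S"
  have "(real N + 1) * measure lebesgue S = (\<Sum>j\<le>N. measure lebesgue (?F j))"
    by (simp add: measure_translation)
  also have "\<dots> = measure lebesgue (\<Union>j\<le>N. ?F j)"
  proof (rule measure_UNION'[symmetric])
    show "pairwise (\<lambda>i j. disjnt (?F i) (?F j)) {..N}"
    proof (rule pairwiseI)
      fix i j :: nat
      assume "i \<noteq> j"
      show "disjnt (?F i) (?F j)"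
      proof (rule ccontr)
        assume "\<not> disjnt (?F i) (?F j)"
        then obtain x y where xy: "x \<in> S" "y \<in> S" "real i *\<^sub>R w + x = real j *\<^sub>R w + y"
          by (auto simp: disjnt_def)
        then have "real i * (2 * R + 1) + a \<bullet> x = real j * (2 * R + 1) + a \<bullet> y"
          by (metis inner_add_right inner_scaleR_right aw)
        then have "\<bar>(real i - real j) * (2 * R + 1)\<bar> \<le> 2 * R"
          using slab[OF xy(1)] slab[OF xy(2)] by (simp add: algebra_simps)
        then have "\<bar>real i - real j\<bar> * (2 * R + 1) \<le> 2 * R"
          using \<open>0 \<le> R\<close> by (simp add: abs_mult)
        moreover have "1 \<le> \<bar>real i - real j\<bar>"
          using \<open>i \<noteq> j\<close> by linarith
        then have "1 * (2 * R + 1) \<le> \<bar>real i - real j\<bar> * (2 * R + 1)"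
          using \<open>0 \<le> R\<close> by (intro mult_right_mono) auto
        ultimately have "1 * (2 * R + 1) \<le> 2 * R"
          by (rule order_trans[rotated])
        then show False
          by simp
      qed
    qed
  qed (auto intro: measurable_translation S)
  also have "\<dots> \<le> measure lebesgue (cball (0::'a) (r + 1))"
  proof (rule measure_mono_fmeasurable)
    show "(\<Union>j\<le>N. ?F j) \<subseteq> cball 0 (r + 1)"
    proof clarsimp
      fix j x
      assume "j \<le> N" "x \<in> S"
      have "norm (real j *\<^sub>R w + x) \<le> real j * norm w + norm x"
        by (rule norm_triangle_le) simp
      also have "real j * norm w \<le> real N * norm w"
        using \<open>j \<le> N\<close> by (intro mult_right_mono) auto
      also have "real N * norm w \<le> 1"
        using N a by (simp add: nw divide_simps)
      also have "norm x \<le> r"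
        using S(2) \<open>x \<in> S\<close> by auto
      finally show "norm (real j *\<^sub>R w + x) \<le> r + 1" by simp
    qed
    show "(\<Union>j\<le>N. ?F j) \<in> sets lebesgue"
      by (intro sets.finite_UN fmeasurableD measurable_translation S) simp
  qed (rule lmeasurable_cball)
  finally show ?thesis .
qed

text \<open>The threshold of half the volume of \<open>P\<close> leaves an overlap whose volume is
  bounded below independently of \<open>g\<close>. This excludes long matrix rows, and any single
  point of the overlap then controls the translation.\<close>

lemma agl_overlap_bounded:
  fixes P Q :: "(real^'n) set"
  assumes P: "compact P" "0 < measure lebesgue P" and Q: "compact Q"
  obtains K where
    "\<And>g i j. g \<in> carrier AGL_int \<Longrightarrow> body_dist P (agl_apply g ` Q) < measure lebesgue P / 2
      \<Longrightarrow> \<bar>real_of_int (fst g $ i $ j)\<bar> \<le> K"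
    "\<And>g. g \<in> carrier AGL_int \<Longrightarrow> body_dist P (agl_apply g ` Q) < measure lebesgue P / 2
      \<Longrightarrow> norm (snd g) \<le> K"
proof -
  obtain R where R: "0 < R" "\<And>x. x \<in> P \<Longrightarrow> norm x \<le> R"
    using compact_imp_bounded[OF P(1)] by (auto simp: bounded_pos)
  obtain r where r: "0 < r" "\<And>x. x \<in> Q \<Longrightarrow> norm x \<le> r"
    using compact_imp_bounded[OF Q] by (auto simp: bounded_pos)
  define V where "V = measure lebesgue (cball (0::real^'n) (r + 1))"
  \<comment> \<open>This \<open>N\<close> makes \<open>N + 1\<close> disjoint copies of any set of
    volume above half that of \<open>P\<close> too large for the ball of volume \<open>V\<close>.
    \<open>L\<close> below is the matching row length in the slab bound.\<close>
  obtain N :: nat where N: "V / (measure lebesgue P / 2) < real N"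
    using reals_Archimedean2 by blast
  have "0 \<le> V" by (simp add: V_def)
  then have "0 < N"
    using N P(2) by (metis divide_nonneg_pos half_gt_zero le_less_trans of_nat_0_less_iff)
  define L where "L = real N * (2 * R + 1)"
  have "0 \<le> L"
    using R by (simp add: L_def)
  have main: "(\<forall>i j. \<bar>real_of_int (fst g $ i $ j)\<bar> \<le> L) \<and> norm (snd g) \<le> CARD('n) * (R + L * r)"
    if g: "g \<in> carrier AGL_int" and d: "body_dist P (agl_apply g ` Q) < measure lebesgue P / 2"
    for g
  proof -
    let ?M = "map_matrix real_of_int (fst g)"
    define S where "S = {x \<in> Q. agl_apply g x \<in> P}"
    have cont: "continuous_on UNIV (agl_apply g)"
      unfolding agl_apply_def by (intro continuous_intros matrix_vector_mult_linear_continuous_on)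
    then have cQ: "compact (agl_apply g ` Q)"
      using Q by (meson compact_continuous_image continuous_on_subset subset_UNIV)
    have "compact (Q \<inter> agl_apply g -` P)"
      using Q cont P(1) by (intro compact_Int_closed closed_vimage compact_imp_closed)
    then have Sm: "S \<in> lmeasurable"
      by (intro lmeasurable_compact) (simp add: S_def vimage_def Collect_conj_eq)
    have gS: "agl_apply g ` S = P \<inter> agl_apply g ` Q"
      by (auto simp: S_def)
    \<comment> \<open>Splitting \<open>P\<close> into its overlap with the image and the rest shows
      that the overlap exceeds half of \<open>P\<close>; volume preservation carries this back to
      \<open>S\<close>.\<close>
    have "measure lebesgue P = measure lebesgue (agl_apply g ` S \<union> (P - agl_apply g ` Q))"
      unfolding gS by (rule arg_cong[of _ _ "measure lebesgue"]) auto
    also have "\<dots> \<le> measure lebesgue (agl_apply g ` S) + measure lebesgue (P - agl_apply g ` Q)"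
      by (intro measure_Un_le fmeasurableD measurable_agl_image g Sm fmeasurable.Diff
          lmeasurable_compact P cQ)
    also have "measure lebesgue (P - agl_apply g ` Q) \<le> body_dist P (agl_apply g ` Q)"
      by (intro measure_le_body_dist P cQ fmeasurableD fmeasurable.Diff lmeasurable_compact) auto
    finally have half: "measure lebesgue P / 2 < measure lebesgue S"
      using d measure_agl_image[OF g Sm] by simp
    have coord: "agl_apply g x $ i = ?M $ i \<bullet> x + snd g $ i" for x i
      by (simp add: agl_apply_def matrix_vector_mul_component)
    have le_R: "\<bar>?M $ i \<bullet> x + snd g $ i\<bar> \<le> R" if "x \<in> S" for x i
      using that R(2)[of "agl_apply g x"] component_le_norm_cart[of "agl_apply g x" i]
      by (simp add: S_def coord)
    have row: "norm (?M $ i) \<le> L" for i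
    proof (rule ccontr)
      assume "\<not> norm (?M $ i) \<le> L"
      then have "(real N + 1) * measure lebesgue S \<le> V"
        unfolding V_def L_def
        using R(1) r \<open>0 < N\<close> le_R Sm
        by (intro measure_slab_bound[where a = "?M $ i" and c = "snd g $ i" and R = R])
           (auto simp: S_def)
      moreover have "(real N + 1) * (measure lebesgue P / 2) < (real N + 1) * measure lebesgue S"
        using half by (intro mult_strict_left_mono) auto
      moreover have "V < real N * (measure lebesgue P / 2)"
        using N P(2) by (simp add: divide_simps)
      ultimately show False
        using P(2) by (simp add: algebra_simps)
    qed
    have "\<bar>real_of_int (fst g $ i $ j)\<bar> \<le> L" for i j
      using component_le_norm_cart[of "?M $ i" j] row[of i] by simp
    moreover have "norm (snd g) \<le> CARD('n) * (R + L * r)"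
    proof -
      \<comment> \<open>\<open>S\<close> has positive volume, so it has a point. At this point
        \<open>agl_apply g x\<close> is bounded by \<open>R\<close> and its linear part by
        \<open>L * r\<close> in each coordinate, and the difference is the translation. Summing over
        coordinates produces the factor \<open>CARD('n)\<close>.\<close>
      obtain x where x: "x \<in> S"
        using half P(2) by (cases "S = {}") auto
      have "\<bar>snd g $ i\<bar> \<le> R + L * r" for i
      proof -
        have "\<bar>?M $ i \<bullet> x\<bar> \<le> norm (?M $ i) * norm x"
          by (rule Cauchy_Schwarz_ineq2)
        also have "\<dots> \<le> L * r"
          using row[of i] r x \<open>0 \<le> L\<close> by (intro mult_mono) (auto simp: S_def)
        finally show ?thesis
          using le_R[OF x, of i] by linarith
      qed
      then have "(\<Sum>i\<in>UNIV. \<bar>snd g $ i\<bar>) \<le> (\<Sum>i\<in>(UNIV::'n set). R + L * r)"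
        by (intro sum_mono)
      then show ?thesis
        using norm_le_l1_cart[of "snd g"] by simp
    qed
    ultimately show ?thesis by blast
  qed
  show ?thesis
  proof (rule that)
    fix g :: "(int^'n^'n) \<times> (real^'n)"
    assume "g \<in> carrier AGL_int" "body_dist P (agl_apply g ` Q) < measure lebesgue P / 2"
    note g = main[OF this]
    show "\<bar>real_of_int (fst g $ i $ j)\<bar> \<le> max L (CARD('n) * (R + L * r))" for i j
      using g by (meson max.coboundedI1)
    show "norm (snd g) \<le> max L (CARD('n) * (R + L * r))"
      using g by (meson max.coboundedI2)
  qed
qed

section \<open>Finiteness of bounded integer matrices\<close>

lemma finite_vec_in_finite:
  assumes "finite T"
  shows "finite {v :: 'a^'k. \<forall>i. v $ i \<in> T}"
proof (rule finite_subset)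
  show "{v :: 'a^'k. \<forall>i. v $ i \<in> T} \<subseteq> vec_lambda ` (UNIV \<rightarrow>\<^sub>E T)"
  proof
    fix v :: "'a^'k"
    assume "v \<in> {v. \<forall>i. v $ i \<in> T}"
    then show "v \<in> vec_lambda ` (UNIV \<rightarrow>\<^sub>E T)"
      by (intro image_eqI[of _ _ "vec_nth v"]) auto
  qed
  show "finite (vec_lambda ` (UNIV \<rightarrow>\<^sub>E T))"
    by (intro finite_imageI finite_PiE assms) simp
qed

lemma finite_bounded_int_matrices:
  "finite {A :: int^'n^'m. \<forall>i j. \<bar>real_of_int (A $ i $ j)\<bar> \<le> K}"
proof -
  \<comment> \<open>The nested form lets the finiteness of vectors apply twice, to the rows and to
    the entries of each row.\<close>
  have "finite {A :: int^'n^'m. \<forall>i. A $ i \<in> {v. \<forall>j. v $ j \<in> {-\<lfloor>K\<rfloor>..\<lfloor>K\<rfloor>}}}"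
    by (intro finite_vec_in_finite finite_atLeastAtMost)
  moreover have "{A :: int^'n^'m. \<forall>i j. \<bar>real_of_int (A $ i $ j)\<bar> \<le> K} \<subseteq>
      {A :: int^'n^'m. \<forall>i. A $ i \<in> {v. \<forall>j. v $ j \<in> {-\<lfloor>K\<rfloor>..\<lfloor>K\<rfloor>}}}"
  proof -
    have "- \<lfloor>K\<rfloor> \<le> z \<and> z \<le> \<lfloor>K\<rfloor>" if "\<bar>real_of_int z\<bar> \<le> K" for z
      using that by linarith
    then show ?thesis by auto
  qed
  ultimately show ?thesis by (rule rev_finite_subset)
qed

section \<open>Closedness of orbits\<close>

text \<open>If the two bodies differed, one set difference would contain a ball. The concentric ball
  of half the radius remains in the corresponding difference for \<open>s k\<close> close to
  \<open>t\<close>, so its volume would bound the distances away from 0.\<close>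

lemma body_eq_translation_limit:
  fixes P Q :: "(real^'n) set" and s :: "nat \<Rightarrow> real^'n"
  assumes P: "P \<in> bodies" and Q: "Q \<in> bodies" "(+) t ` Q \<in> bodies"
    and s: "s \<longlonglongrightarrow> t" and lim: "(\<lambda>k. body_dist P ((+) (s k) ` Q)) \<longlonglongrightarrow> 0"
  shows "P = (+) t ` Q"
proof -
  have cP: "compact P" and cQ: "compact ((+) c ` Q)" for c
    using P Q by (auto simp: bodies_def intro: compact_translation)
  have no_ball: False if "0 < e"
    and sub: "\<And>k. dist (s k) t < e / 2 \<Longrightarrow>
      ball x (e / 2) \<subseteq> P - (+) (s k) ` Q \<or> ball x (e / 2) \<subseteq> (+) (s k) ` Q - P" for x e
  proof -
    have pos: "0 < measure lebesgue (ball x (e / 2))"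
      using content_ball_pos[of "e / 2" x] \<open>0 < e\<close> by simp
    have "\<forall>\<^sub>F k in sequentially. dist (s k) t < e / 2"
      using s \<open>0 < e\<close> by (intro tendstoD) auto
    moreover have "\<forall>\<^sub>F k in sequentially.
        body_dist P ((+) (s k) ` Q) < measure lebesgue (ball x (e / 2))"
      using lim pos by (rule order_tendstoD)
    ultimately have "\<forall>\<^sub>F k in sequentially. False"
    proof eventually_elim
      case (elim k)
      from sub[OF elim(1)]
      have "measure lebesgue (ball x (e / 2)) \<le> body_dist P ((+) (s k) ` Q)"
        using measure_le_body_dist[OF cP cQ[of "s k"], of "ball x (e / 2)"]
          measure_le_body_dist[OF cQ[of "s k"] cP, of "ball x (e / 2)"]
        by (auto simp: body_dist_commute)
      with elim(2) show False by simp
    qed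
    then show False by simp
  qed
  \<comment> \<open>\<open>y\<close> lies in the translate by \<open>s k\<close> exactly when
    \<open>y - s k + t\<close> lies in the translate by \<open>t\<close>. This correction moves
    \<open>y\<close> by less than \<open>e / 2\<close>, so it stays within the larger ball.\<close>
  have shift: "dist x (y - s k + t) < e" if "dist x y < e / 2" "dist (s k) t < e / 2" for x y k e
    using that norm_triangle_ineq[of "x - y" "s k - t"] by (simp add: dist_norm algebra_simps)
  have mem: "y \<in> (+) c ` Q \<longleftrightarrow> y - c \<in> Q" for y c
    by (auto simp: image_iff intro: bexI[of _ "y - c"])
  show ?thesis
  proof (rule equalityI; rule ccontr)
    assume "\<not> P \<subseteq> (+) t ` Q"
    then obtain x e where e: "0 < e" "ball x e \<subseteq> P - (+) t ` Q"
      using body_ball_in_diff[OF P compact_imp_closed[OF cQ]] by metis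
    have "ball x (e / 2) \<subseteq> P - (+) (s k) ` Q" if "dist (s k) t < e / 2" for k
    proof
      fix y
      assume y: "y \<in> ball x (e / 2)"
      then have "y \<in> P"
        using e by (auto simp: subset_iff)
      moreover have "y - s k + t \<in> ball x e"
        using shift[OF _ that] y by simp
      ultimately show "y \<in> P - (+) (s k) ` Q"
        using e(2) by (auto simp: mem subset_iff)
    qed
    with no_ball[OF e(1)] show False by blast
  next
    assume "\<not> (+) t ` Q \<subseteq> P"
    then obtain x e where e: "0 < e" "ball x e \<subseteq> (+) t ` Q - P"
      using body_ball_in_diff[OF Q(2) compact_imp_closed[OF cP]] by metis
    have "ball x (e / 2) \<subseteq> (+) (s k) ` Q - P" if "dist (s k) t < e / 2" for k
    proof
      fix y
      assume y: "y \<in> ball x (e / 2)"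
      then have "y \<in> ball x e"
        using e(1) by auto
      then have "y \<notin> P"
        using e(2) by blast
      moreover have "y - s k + t \<in> ball x e"
        using shift[OF _ that] y by simp
      then have "y - s k + t \<in> (+) t ` Q"
        using e(2) by blast
      ultimately show "y \<in> (+) (s k) ` Q - P"
        by (simp add: mem)
    qed
    with no_ball[OF e(1)] show False by blast
  qed
qed

text \<open>This supplies definiteness: orbits at infimal distance 0 coincide.\<close>

lemma agl_orbit_closed:
  fixes P Q :: "(real^'n) set"
  assumes P: "P \<in> bodies" and Q: "Q \<in> bodies"
    and near: "\<And>e. 0 < e \<Longrightarrow> \<exists>g\<in>carrier AGL_int. body_dist P (agl_apply g ` Q) < e"
  shows "\<exists>g\<in>carrier AGL_int. P = agl_apply g ` Q"
proof (cases "P = {}")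
  \<comment> \<open>The overlap bound needs positive volume of \<open>P\<close>. For empty
    \<open>P\<close> all the distances equal the volume of \<open>Q\<close>, which must then be 0,
    and only the empty body is null.\<close>
  case True
  have "Q \<in> lmeasurable"
    using Q by (auto simp: bodies_def lmeasurable_compact)
  then have "body_dist P (agl_apply g ` Q) = measure lebesgue Q" if "g \<in> carrier AGL_int" for g
    using that by (simp add: True body_dist_def measure_agl_image)
  then have "\<not> 0 < measure lebesgue Q"
    using near by fastforce
  then have "Q = {}"
    using body_measure_pos[OF Q] by blast
  with True show ?thesis
    \<comment> \<open>Only some group element is needed here, since every one maps the empty set to
      itself.\<close>
    using near[of 1] by auto
next
  case False
  have cP: "compact P" and cQ: "compact Q"
    using P Q by (auto simp: bodies_def)
  have pos: "0 < measure lebesgue P"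
    using False P by (rule body_measure_pos[rotated])
  obtain K where
    K1: "\<And>g i j. g \<in> carrier AGL_int \<Longrightarrow> body_dist P (agl_apply g ` Q) < measure lebesgue P / 2
      \<Longrightarrow> \<bar>real_of_int (fst g $ i $ j)\<bar> \<le> K" and
    K2: "\<And>g. g \<in> carrier AGL_int \<Longrightarrow> body_dist P (agl_apply g ` Q) < measure lebesgue P / 2
      \<Longrightarrow> norm (snd g) \<le> K"
    using agl_overlap_bounded[OF cP pos cQ] by metis
  \<comment> \<open>The first term of the minimum keeps \<open>g k\<close> in the range of the bound
    \<open>K\<close>; the second forces convergence.\<close>
  have "\<exists>g\<in>carrier AGL_int. body_dist P (agl_apply g ` Q)
      < min (measure lebesgue P / 2) (inverse (real (Suc k)))" for k
    using pos by (intro near) simp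
  then obtain g where g: "\<And>k. g k \<in> carrier AGL_int"
      "\<And>k. body_dist P (agl_apply (g k) ` Q) < measure lebesgue P / 2"
      "\<And>k. body_dist P (agl_apply (g k) ` Q) < inverse (real (Suc k))"
    by (metis min_less_iff_conj)
  \<comment> \<open>Only finitely many matrices occur, so one of them recurs infinitely often;
    bounded translations then give a further convergent subsequence.\<close>
  have "finite (range (\<lambda>k. fst (g k)))"
    using K1[OF g(1,2)] by (intro finite_subset[OF _ finite_bounded_int_matrices[of K]]) auto
  then obtain k0 where "infinite {k. fst (g k) = fst (g k0)}"
    using pigeonhole_infinite[of UNIV "\<lambda>k. fst (g k)"] by auto
  then obtain r :: "nat \<Rightarrow> nat" where r: "strict_mono r" "\<And>k. fst (g (r k)) = fst (g k0)"
    using infinite_enumerate by blast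
  have "bounded (range (\<lambda>k. snd (g (r k))))"
    using K2[OF g(1,2)] by (auto simp: bounded_iff)
  then obtain t q where q: "strict_mono (q :: nat \<Rightarrow> nat)" "((\<lambda>k. snd (g (r k))) \<circ> q) \<longlonglongrightarrow> t"
    using bounded_imp_convergent_subsequence by blast
  let ?A = "fst (g k0)"
  \<comment> \<open>Absorbing the now constant matrix into \<open>?Q\<close> leaves a sequence of
    pure translations.\<close>
  let ?Q = "agl_apply (?A, 0) ` Q"
  have "?A \<in> GL_int"
    using g(1)[of k0] by (auto simp: AGL_int_def)
  then have A: "(?A, c) \<in> carrier AGL_int" for c
    by (auto simp: AGL_int_def)
  have split: "agl_apply (?A, c) ` Q = (+) c ` ?Q" for c
    by (simp add: agl_apply_image image_image)
  have "P = (+) t ` ?Q"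
  proof (rule body_eq_translation_limit[OF P])
    show "?Q \<in> bodies" "(+) t ` ?Q \<in> bodies"
      using agl_apply_bodies[OF A Q] by (simp_all flip: split)
    show "(\<lambda>k. snd (g (r (q k)))) \<longlonglongrightarrow> t"
      using q(2) by (simp add: o_def)
    have "(+) (snd (g (r (q k)))) ` ?Q = agl_apply (g (r (q k))) ` Q" for k
      unfolding split[symmetric] by (metis prod.collapse r(2))
    moreover have "(\<lambda>k. body_dist P (agl_apply (g k) ` Q)) \<longlonglongrightarrow> 0"
      using g(3) by (intro real_tendsto_sandwich[OF _ _ tendsto_const LIMSEQ_inverse_real_of_nat])
        (auto simp: body_dist_nonneg less_imp_le)
    from LIMSEQ_subseq_LIMSEQ[OF this strict_mono_o[OF r(1) q(1)]]
    have "(\<lambda>k. body_dist P (agl_apply (g (r (q k))) ` Q)) \<longlonglongrightarrow> 0"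
      by (simp add: o_def)
    ultimately show "(\<lambda>k. body_dist P ((+) (snd (g (r (q k)))) ` ?Q)) \<longlonglongrightarrow> 0"
      by simp
  qed
  with A split show ?thesis by metis
qed

section \<open>The distance on orbits\<close>

text \<open>The right-hand side unfolds membership of \<open>P\<close> in the orbit of
  \<open>Q\<close>. Membership amounts to equality because distinct orbits are disjoint.\<close>

lemma body_class_eq_iff:
  fixes P Q :: "(real^'n) set"
  assumes "P \<in> bodies" "Q \<in> bodies"
  shows "body_class P = body_class Q \<longleftrightarrow> (\<exists>g\<in>carrier AGL_int. P = agl_apply g ` Q)"
proof -
  interpret group_action "AGL_int :: ((int^'n^'n) \<times> (real^'n)) monoid" bodies body_action
    by (rule group_action_bodies)
  have "P \<in> body_class Q \<longleftrightarrow> (\<exists>g\<in>carrier AGL_int. P = agl_apply g ` Q)"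
    using assms by (auto simp: orbit_def body_action_def)
  moreover have "body_class P = body_class Q \<longleftrightarrow> P \<in> body_class Q"
  proof
    show "body_class P = body_class Q" if "P \<in> body_class Q"
      using disjoint_union[of "body_class P" "body_class Q"] orbit_refl[OF assms(1)] assms that
      by (auto simp: orbits_def)
  qed (use orbit_refl[OF assms(1)] in auto)
  ultimately show ?thesis by simp
qed

lemma moduli_dist_le:
  assumes "P \<in> bodies" "Q \<in> bodies"
  shows "moduli_dist (body_class P) (body_class Q) \<le> body_dist P Q"
proof -
  have "body_class P \<in> body_moduli" "body_class Q \<in> body_moduli"
    using assms by (auto simp: body_moduli_def orbits_def)
  then show ?thesis
    unfolding moduli_dist_def using assms
    by (auto intro!: cInf_lower bdd_belowI[of _ 0] simp: body_dist_nonneg)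
qed

text \<open>One representative can be kept fixed in the infimum: a nearly optimal pair is moved by
  the isometry that carries its first member to \<open>P\<close>, and its second member remains in
  the orbit of \<open>Q\<close>.\<close>

lemma moduli_dist_approx:
  fixes P Q :: "(real^'n) set"
  assumes P: "P \<in> bodies" and Q: "Q \<in> bodies"
    and less: "moduli_dist (body_class P) (body_class Q) < e"
  shows "\<exists>g\<in>carrier AGL_int. body_dist P (agl_apply g ` Q) < e"
proof -
  interpret G: group "AGL_int :: ((int^'n^'n) \<times> (real^'n)) monoid"
    by (rule group_AGL_int)
  define D where "D = {body_dist P1 P2 | P1 P2. P1 \<in> bodies \<and> P2 \<in> bodies \<and>
      body_class P1 = body_class P \<and> body_class P2 = body_class Q}"
  have "body_class P \<in> body_moduli" "body_class Q \<in> body_moduli"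
    using assms by (auto simp: body_moduli_def orbits_def)
  then have "Inf D < e"
    using less by (simp add: moduli_dist_def D_def)
  moreover have "D \<noteq> {}"
    using P Q by (auto simp: D_def)
  ultimately obtain d where "d \<in> D" "d < e"
    using cInf_lessD by blast
  then obtain P1 P2 where 12: "P1 \<in> bodies" "P2 \<in> bodies" "body_dist P1 P2 < e"
      "body_class P = body_class P1" "body_class P2 = body_class Q"
    by (auto simp: D_def)
  then obtain g h where g: "g \<in> carrier AGL_int" "P = agl_apply g ` P1"
    and h: "h \<in> carrier AGL_int" "P2 = agl_apply h ` Q"
    using P Q body_class_eq_iff by metis
  have "agl_apply (g \<otimes>\<^bsub>AGL_int\<^esub> h) ` Q = agl_apply g ` P2"
    by (simp add: h image_image agl_apply_mult)
  then have "body_dist P (agl_apply (g \<otimes>\<^bsub>AGL_int\<^esub> h) ` Q) = body_dist P1 P2"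
    using 12 g by (simp add: body_dist_agl_image bodies_def)
  with 12(3) have "body_dist P (agl_apply (g \<otimes>\<^bsub>AGL_int\<^esub> h) ` Q) < e"
    by (rule ord_eq_less_trans[rotated])
  then show ?thesis
    by (rule bexI) (rule G.m_closed[OF g(1) h(1)])
qed

theorem theorem3p2:
  shows "Metric_space (body_moduli :: (real^'n) set set set) moduli_dist"
proof
  show nonneg: "0 \<le> moduli_dist \<alpha> \<beta>" for \<alpha> \<beta> :: "(real^'n) set set"
  proof (cases "\<alpha> \<in> body_moduli \<and> \<beta> \<in> body_moduli")
    case True
    then have "{body_dist P1 P2 | P1 P2. P1 \<in> bodies \<and> P2 \<in> bodies \<and>
        body_class P1 = \<alpha> \<and> body_class P2 = \<beta>} \<noteq> {}"
      by (auto simp: body_moduli_def orbits_def)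
    with True show ?thesis
      unfolding moduli_dist_def by (auto intro!: cInf_greatest simp: body_dist_nonneg)
  qed (auto simp: moduli_dist_def)
  fix \<alpha> \<beta> :: "(real^'n) set set"
  have "{body_dist P1 P2 | P1 P2. P1 \<in> bodies \<and> P2 \<in> bodies \<and>
        body_class P1 = \<alpha> \<and> body_class P2 = \<beta>} =
      {body_dist P1 P2 | P1 P2. P1 \<in> bodies \<and> P2 \<in> bodies \<and>
        body_class P1 = \<beta> \<and> body_class P2 = \<alpha>}"
    by (metis (no_types, opaque_lifting) body_dist_commute)
  then show "moduli_dist \<alpha> \<beta> = moduli_dist \<beta> \<alpha>"
    by (simp add: moduli_dist_def conj_commute)
  assume "\<alpha> \<in> body_moduli" "\<beta> \<in> body_moduli"
  then obtain P Q where P: "P \<in> bodies" "\<alpha> = body_class P" and Q: "Q \<in> bodies" "\<beta> = body_class Q"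
    by (auto simp: body_moduli_def orbits_def)
  show "moduli_dist \<alpha> \<beta> = 0 \<longleftrightarrow> \<alpha> = \<beta>"
  proof
    assume "moduli_dist \<alpha> \<beta> = 0"
    \<comment> \<open>Infimum 0 means that every positive \<open>e\<close> is undercut by some image
      of \<open>Q\<close>, which is the hypothesis of orbit closedness.\<close>
    then have "\<exists>g\<in>carrier AGL_int. P = agl_apply g ` Q"
      using P Q by (intro agl_orbit_closed moduli_dist_approx) auto
    then show "\<alpha> = \<beta>"
      using P Q body_class_eq_iff by blast
  next
    assume "\<alpha> = \<beta>"
    then have "moduli_dist \<alpha> \<beta> \<le> body_dist P P"
      using moduli_dist_le[OF P(1) P(1)] P by simp
    also have "\<dots> = 0"
      by (simp add: body_dist_def)
    finally show "moduli_dist \<alpha> \<beta> = 0"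
      using nonneg by (simp add: antisym)
  qed
next
  fix \<alpha> \<beta> \<gamma> :: "(real^'n) set set"
  assume "\<alpha> \<in> body_moduli" "\<beta> \<in> body_moduli" "\<gamma> \<in> body_moduli"
  then obtain P Q R where P: "P \<in> bodies" "\<alpha> = body_class P" and Q: "Q \<in> bodies" "\<beta> = body_class Q"
    and R: "R \<in> bodies" "\<gamma> = body_class R"
    by (auto simp: body_moduli_def orbits_def)
  show "moduli_dist \<alpha> \<gamma> \<le> moduli_dist \<alpha> \<beta> + moduli_dist \<beta> \<gamma>"
  proof (rule field_le_epsilon)
    fix e :: real
    assume "0 < e"
    \<comment> \<open>The approximations are chained through one middle representative: first
      \<open>?Q\<close> near \<open>P\<close>, then \<open>?R\<close> near this same
      \<open>?Q\<close>, each with error \<open>e / 2\<close>, so that the triangle inequality for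
      bodies applies.\<close>
    obtain g where g: "g \<in> carrier AGL_int"
      "body_dist P (agl_apply g ` Q) < moduli_dist \<alpha> \<beta> + e / 2"
      using moduli_dist_approx[OF P(1) Q(1), of "moduli_dist \<alpha> \<beta> + e / 2"] P Q \<open>0 < e\<close> by auto
    let ?Q = "agl_apply g ` Q"
    have gQ: "?Q \<in> bodies" "\<beta> = body_class ?Q"
      using agl_apply_bodies[OF g(1) Q(1)] body_class_eq_iff[of ?Q Q] Q g(1) by auto
    obtain h where h: "h \<in> carrier AGL_int"
      "body_dist ?Q (agl_apply h ` R) < moduli_dist \<beta> \<gamma> + e / 2"
      using moduli_dist_approx[OF gQ(1) R(1), of "moduli_dist \<beta> \<gamma> + e / 2"] gQ R \<open>0 < e\<close> by auto
    let ?R = "agl_apply h ` R"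
    have hR: "?R \<in> bodies" "\<gamma> = body_class ?R"
      using agl_apply_bodies[OF h(1) R(1)] body_class_eq_iff[of ?R R] R h(1) by auto
    have "moduli_dist \<alpha> \<gamma> \<le> body_dist P ?R"
      using moduli_dist_le[OF P(1) hR(1)] P hR by simp
    also have "\<dots> \<le> body_dist P ?Q + body_dist ?Q ?R"
      using P gQ hR by (intro body_dist_triangle) (auto simp: bodies_def)
    finally show "moduli_dist \<alpha> \<gamma> \<le> moduli_dist \<alpha> \<beta> + moduli_dist \<beta> \<gamma> + e"
      using g(2) h(2) by simp
  qed
qed

end
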